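(* Let $\boldsymbol\lambda\in\mathbb R^{|W|}$ be fixed and consider the problem $$\sum_{w\in W}t_w\lambda_w+\max\ \sum_{w\in W}(\bar p_w-\lambda_w)\Big[\sum_{(i,j)\in P}c_{ijw}\frac{\bar d_{ijw}}{\mathbf d(i,j)}t_{ij}+\sum_{i\in V^0}c_{iw}y_i\Big],$$ where the maximum is over all paths $P\in\mathcal P$, travel times $(t_{ij})_{(i,j)\in P}$ and idling times $(y_i)_{i\in V}$ satisfying (a) $\frac{\mathbf d(i,j)}{\bar\tau}\le t_{ij}\le\frac{\mathbf d(i,j)}{\underline\tau}$ for all $(i,j)\in P$; (b) $y_i=0$ for $i\in\{0,n+1\}$, $y_i\ge0$ for $i\in V^0$, and $y_i=0$ for every $i\in V^0$ not visited by $P$; (c) $\sum_{(i,j)\in P}t_{ij}+\sum_{i\in V^0}y_i\le T$. Suppose this problem is feasible. Then it has an optimal solution in which the vehicle idles at no more than one waypoint, i.e. among all waypoints $i\in V^0$ there exists at most one waypoint $\bar v$ with $y_{\bar v}>0$.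
   Context: $V=\{0,1,\dots,n,n+1\}$ is a finite set of waypoints (points in the plane), with $0$ and $n+1$ the insertion and extraction depots, $V^0=V\setminus\{0,n+1\}$, $W$ is a finite set of targets (points in the plane), and $A=((V\setminus\{n+1\})\times V)\setminus(\{(i,i):i\in V\}\cup\{(0,n+1)\})$. $\mathbf d(\cdot,\cdot)$ is Euclidean distance, with $\mathbf d(i,j)>0$ for $(i,j)\in A$. $\mathcal P$ is the set of feasible paths from $0$ to $n+1$ using arcs of $A$, each visiting any waypoint at most once; $P$ is identified with its set of arcs. $\bar p_w$ is the priority of target $w$, $t_w$ its required coverage, $0<\underline\tau\le\bar\tau$ are the minimum and maximum vehicle speeds, and $T$ is the operational deadline. All vehicles are identical, with coverage radius $\bar\eta$ and coverage factor $\rho$. For $(i,j)\in A$ and $w\in W$, let $[i',j']$ be the intersection of the segment $[i,j]$ with the disc of radius $\bar\eta$ about $w$, let $\bar\theta$ be the angle at $w$ between the vectors from $w$ to $i'$ and from $w$ to $j'$, and put $\bar d_{ijw}=\mathbf d(i',j')$ and $c_{ijw}=\rho\frac{\bar\theta}{\sin\bar\theta\,\mathbf d(i',w)\,\mathbf d(j',w)}$ (with $\theta/\sin\theta=1$ at $\theta=0$, and the product $c_{ijw}\bar d_{ijw}$ equal to $0$ if the intersection is empty). For $i\in V^0$, $c_{iw}=\rho/\mathbf d(i,w)^2$ if $\mathbf d(i,w)\le\bar\eta$, else $0$. Data are such that all coefficients are well-defined finite real numbers. *)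

theory Defs
  imports "HOL-Analysis.Analysis"
begin

section \<open>Waypoint network\<close>

text \<open>Waypoints are labelled \<open>0, \<dots>, n + 1\<close>, with depots \<open>0\<close> and \<open>n + 1\<close>; their locations are
  given separately, so that distinct labels (e.g. the two depots) may share a location.\<close>

definition inner_waypoints :: "nat \<Rightarrow> nat set" where
  "inner_waypoints n = {0..n + 1} - {0, n + 1}"

definition arcs :: "nat \<Rightarrow> (nat \<times> nat) set" where
  "arcs n = (({0..n + 1} - {n + 1}) \<times> {0..n + 1}) - ({(i, i) | i. i \<in> {0..n + 1}} \<union> {(0, n + 1)})"

definition arcs_of_walk :: "nat list \<Rightarrow> (nat \<times> nat) set" where
  "arcs_of_walk vs = set (zip vs (tl vs))"

definition paths :: "nat \<Rightarrow> (nat \<times> nat) set set" where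
  "paths n = {arcs_of_walk vs | vs.
     vs \<noteq> [] \<and> hd vs = 0 \<and> last vs = n + 1 \<and> distinct vs \<and> arcs_of_walk vs \<subseteq> arcs n}"


section \<open>Coverage coefficients\<close>

text \<open>The end points \<open>(i', j')\<close> of the part of the segment from \<open>a\<close> to \<open>b\<close> lying in the disc of
  radius \<open>r\<close> about \<open>w\<close>, where \<open>i'\<close> is the one closer to \<open>a\<close>. Meaningful only if the intersection
  is nonempty.\<close>

definition chord_ends :: "real^2 \<Rightarrow> real^2 \<Rightarrow> real^2 \<Rightarrow> real \<Rightarrow> (real^2) \<times> (real^2)" where
  "chord_ends a b w r = (THE (i', j').
     closed_segment i' j' = closed_segment a b \<inter> cball w r \<and> dist a i' \<le> dist a j')"

lemma chord_ends_ex1: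
  assumes ne: "closed_segment a b \<inter> cball w r \<noteq> {}"
  shows "\<exists>!(i', j'). closed_segment i' j' = closed_segment a b \<inter> cball w (r :: real)
           \<and> dist a i' \<le> dist a (j' :: real^2)"
proof -
  let ?S = "closed_segment a b \<inter> cball w r"
  have "compact ?S" "convex ?S"
    by (auto intro: convex_Int)
  moreover have "collinear ?S"
    by (rule collinear_subset[OF collinear_closed_segment]) auto
  ultimately obtain u v where uv: "?S = closed_segment u v"
    using ne compact_convex_collinear_segment by metis
  have uniq: "x = y" if "x \<in> ?S" "y \<in> ?S" "dist a x = dist a y" for x y
  proof -
    obtain s t where x: "x = (1 - s) *\<^sub>R a + s *\<^sub>R b" "0 \<le> s"
      and y: "y = (1 - t) *\<^sub>R a + t *\<^sub>R b" "0 \<le> t"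
      using \<open>x \<in> ?S\<close> \<open>y \<in> ?S\<close> unfolding closed_segment_def by blast
    have "a - x = s *\<^sub>R (a - b)" "a - y = t *\<^sub>R (a - b)"
      using x(1) y(1) by (simp_all add: algebra_simps)
    then have "s * norm (a - b) = t * norm (a - b)"
      using that(3) x(2) y(2) by (simp add: dist_norm)
    then consider "s = t" | "a = b" by auto
    then show "x = y"
      using x(1) y(1) by cases (simp_all flip: scaleR_left.add)
  qed
  define p where "p = (if dist a u \<le> dist a v then (u, v) else (v, u))"
  show ?thesis
  proof (rule ex1I[of _ p])
    show "case p of (i', j') \<Rightarrow> closed_segment i' j' = ?S \<and> dist a i' \<le> dist a j'"
      using uv by (auto simp: p_def closed_segment_commute)
  next
    fix q assume q: "case q of (i', j') \<Rightarrow> closed_segment i' j' = ?S \<and> dist a i' \<le> dist a j'"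
    obtain i' j' where ij: "q = (i', j')" by (cases q)
    have "{i', j'} = {u, v}"
      using q uv ij closed_segment_eq by fastforce
    moreover have "u \<in> ?S" "v \<in> ?S" unfolding uv by auto
    ultimately show "q = p"
      using q ij uniq[of u v] unfolding p_def doubleton_eq_iff by fastforce
  qed
qed

definition angle_at :: "real^2 \<Rightarrow> real^2 \<Rightarrow> real^2 \<Rightarrow> real" where
  "angle_at w x y = arccos (((x - w) \<bullet> (y - w)) / (norm (x - w) * norm (y - w)))"

definition chord_length :: "real^2 \<Rightarrow> real^2 \<Rightarrow> real^2 \<Rightarrow> real \<Rightarrow> real" where
  "chord_length a b w r =
     (if closed_segment a b \<inter> cball w r = {} then 0
      else (let (i', j') = chord_ends a b w r in dist i' j'))"

definition arc_coeff :: "real \<Rightarrow> real^2 \<Rightarrow> real^2 \<Rightarrow> real^2 \<Rightarrow> real \<Rightarrow> real" where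
  "arc_coeff \<rho> a b w r =
     (if closed_segment a b \<inter> cball w r = {} then 0
      else (let (i', j') = chord_ends a b w r; \<theta> = angle_at w i' j' in
        \<rho> * ((if \<theta> = 0 then 1 else \<theta> / sin \<theta>) / (dist i' w * dist j' w))))"

definition point_coeff :: "real \<Rightarrow> real^2 \<Rightarrow> real^2 \<Rightarrow> real \<Rightarrow> real" where
  "point_coeff \<rho> v w r = (if dist v w \<le> r then \<rho> / (dist v w)\<^sup>2 else 0)"

text \<open>No denominator in the coefficients vanishes (HOL would totalize the division to \<open>0\<close>).\<close>

definition arc_coeff_well_defined :: "real^2 \<Rightarrow> real^2 \<Rightarrow> real^2 \<Rightarrow> real \<Rightarrow> bool" where
  "arc_coeff_well_defined a b w r \<longleftrightarrow>
     (closed_segment a b \<inter> cball w r \<noteq> {} \<longrightarrow>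
       (let (i', j') = chord_ends a b w r; \<theta> = angle_at w i' j' in
         dist i' w \<noteq> 0 \<and> dist j' w \<noteq> 0 \<and> (\<theta> = 0 \<or> sin \<theta> \<noteq> 0)))"

definition point_coeff_well_defined :: "real^2 \<Rightarrow> real^2 \<Rightarrow> real \<Rightarrow> bool" where
  "point_coeff_well_defined v w r \<longleftrightarrow> (dist v w \<le> r \<longrightarrow> dist v w \<noteq> 0)"


section \<open>The single-vehicle problem\<close>

text \<open>A solution is a triple \<open>(P, t, y)\<close>. Only the values of \<open>t\<close> on \<open>P\<close> and of \<open>y\<close> on
  \<open>{0..n + 1}\<close> matter.\<close>

definition feasible ::
  "nat \<Rightarrow> (nat \<Rightarrow> real^2) \<Rightarrow> real \<Rightarrow> real \<Rightarrow> real \<Rightarrow>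
   (nat \<times> nat) set \<Rightarrow> (nat \<times> nat \<Rightarrow> real) \<Rightarrow> (nat \<Rightarrow> real) \<Rightarrow> bool" where
  "feasible n pos \<tau>min \<tau>max T P t y \<longleftrightarrow>
     P \<in> paths n \<and>
     (\<forall>(i, j)\<in>P. dist (pos i) (pos j) / \<tau>max \<le> t (i, j) \<and> t (i, j) \<le> dist (pos i) (pos j) / \<tau>min) \<and>
     (\<forall>i\<in>{0, n + 1}. y i = 0) \<and>
     (\<forall>i\<in>inner_waypoints n. 0 \<le> y i) \<and>
     (\<forall>i\<in>inner_waypoints n. i \<notin> Field P \<longrightarrow> y i = 0) \<and>
     (\<Sum>(i, j)\<in>P. t (i, j)) + (\<Sum>i\<in>inner_waypoints n. y i) \<le> T"

definition objective ::
  "nat \<Rightarrow> (nat \<Rightarrow> real^2) \<Rightarrow> 'w set \<Rightarrow> ('w \<Rightarrow> real^2) \<Rightarrow> ('w \<Rightarrow> real) \<Rightarrow> ('w \<Rightarrow> real) \<Rightarrow>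
   real \<Rightarrow> real \<Rightarrow> ('w \<Rightarrow> real) \<Rightarrow>
   (nat \<times> nat) set \<Rightarrow> (nat \<times> nat \<Rightarrow> real) \<Rightarrow> (nat \<Rightarrow> real) \<Rightarrow> real" where
  "objective n pos W tgt prio req \<rho> \<eta> lam P t y =
     (\<Sum>w\<in>W. req w * lam w) +
     (\<Sum>w\<in>W. (prio w - lam w) *
       ((\<Sum>(i, j)\<in>P. arc_coeff \<rho> (pos i) (pos j) (tgt w) \<eta> *
            (chord_length (pos i) (pos j) (tgt w) \<eta> / dist (pos i) (pos j)) * t (i, j)) +
        (\<Sum>i\<in>inner_waypoints n. point_coeff \<rho> (pos i) (tgt w) \<eta> * y i)))"

definition optimal ::
  "nat \<Rightarrow> (nat \<Rightarrow> real^2) \<Rightarrow> 'w set \<Rightarrow> ('w \<Rightarrow> real^2) \<Rightarrow> ('w \<Rightarrow> real) \<Rightarrow> ('w \<Rightarrow> real) \<Rightarrow>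
   real \<Rightarrow> real \<Rightarrow> real \<Rightarrow> real \<Rightarrow> real \<Rightarrow> ('w \<Rightarrow> real) \<Rightarrow>
   (nat \<times> nat) set \<Rightarrow> (nat \<times> nat \<Rightarrow> real) \<Rightarrow> (nat \<Rightarrow> real) \<Rightarrow> bool" where
  "optimal n pos W tgt prio req \<tau>min \<tau>max T \<rho> \<eta> lam P t y \<longleftrightarrow>
     feasible n pos \<tau>min \<tau>max T P t y \<and>
     (\<forall>P' t' y'. feasible n pos \<tau>min \<tau>max T P' t' y' \<longrightarrow>
        objective n pos W tgt prio req \<rho> \<eta> lam P' t' y'
          \<le> objective n pos W tgt prio req \<rho> \<eta> lam P t y)"

end

theory Submission
  imports Defs
begin

text \<open>
  For a fixed path \<open>P\<close> the objective is an affine function of the travel times and the idling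
  times: each unit of time spent on an arc \<open>e\<close> earns a constant amount, and each unit of time spent
  idling at a waypoint \<open>i\<close> earns a constant amount \<open>idle_gain i\<close> (lemma \<open>objective_affine\<close>).

  An optimal solution exists. Travel times are confined to intervals by the speed limits, and idling
  times lie in \<open>[0, T]\<close> because travel times are nonnegative and the total time is at most \<open>T\<close>. After
  the irrelevant coordinates have been set to \<open>0\<close>, the solutions with path \<open>P\<close> therefore form a
  compact set, on which the continuous objective attains its maximum (lemma \<open>optimal_on_path\<close>).
  There are only finitely many paths, so one of these maxima is the largest.

  Now take an optimal solution and, unless its path avoids all inner waypoints, move all of its
  idling time to a visited inner waypoint with the largest \<open>idle_gain\<close>. The constraints involve
  the idling times of the visited inner waypoints only through nonnegativity and their sum, so the new solution is feasible, and the
  objective does not decrease (lemma \<open>concentrate_idling\<close>).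
\<close>

section \<open>Paths\<close>

lemma finite_inner_waypoints: "finite (inner_waypoints n)"
  by (simp add: inner_waypoints_def)

lemma paths_subset_arcs: "P \<in> paths n \<Longrightarrow> P \<subseteq> arcs n"
  by (auto simp: paths_def)

lemma finite_arcs: "finite (arcs n)"
  by (simp add: arcs_def)

lemma finite_paths: "finite (paths n)"
proof (rule finite_subset)
  show "paths n \<subseteq> Pow (arcs n)"
    using paths_subset_arcs by blast
qed (simp add: finite_arcs)

section \<open>The objective is affine in the times\<close>

definition arc_gain ::
  "(nat \<Rightarrow> real^2) \<Rightarrow> 'w set \<Rightarrow> ('w \<Rightarrow> real^2) \<Rightarrow> ('w \<Rightarrow> real) \<Rightarrow> real \<Rightarrow> real \<Rightarrow> ('w \<Rightarrow> real) \<Rightarrow>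
   nat \<times> nat \<Rightarrow> real" where
  "arc_gain pos W tgt prio \<rho> \<eta> lam = (\<lambda>(i, j). \<Sum>w\<in>W. (prio w - lam w) *
     (arc_coeff \<rho> (pos i) (pos j) (tgt w) \<eta> *
       (chord_length (pos i) (pos j) (tgt w) \<eta> / dist (pos i) (pos j))))"

definition idle_gain ::
  "(nat \<Rightarrow> real^2) \<Rightarrow> 'w set \<Rightarrow> ('w \<Rightarrow> real^2) \<Rightarrow> ('w \<Rightarrow> real) \<Rightarrow> real \<Rightarrow> real \<Rightarrow> ('w \<Rightarrow> real) \<Rightarrow>
   nat \<Rightarrow> real" where
  "idle_gain pos W tgt prio \<rho> \<eta> lam i =
     (\<Sum>w\<in>W. (prio w - lam w) * point_coeff \<rho> (pos i) (tgt w) \<eta>)"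

lemma objective_affine:
  "objective n pos W tgt prio req \<rho> \<eta> lam P t y =
     (\<Sum>w\<in>W. req w * lam w) + (\<Sum>e\<in>P. arc_gain pos W tgt prio \<rho> \<eta> lam e * t e) +
     (\<Sum>i\<in>inner_waypoints n. idle_gain pos W tgt prio \<rho> \<eta> lam i * y i)"
proof -
  have arcs: "(\<Sum>w\<in>W. (prio w - lam w) * (\<Sum>(i, j)\<in>P. arc_coeff \<rho> (pos i) (pos j) (tgt w) \<eta> *
        (chord_length (pos i) (pos j) (tgt w) \<eta> / dist (pos i) (pos j)) * t (i, j))) =
      (\<Sum>e\<in>P. arc_gain pos W tgt prio \<rho> \<eta> lam e * t e)"
    unfolding sum_distrib_left
    by (subst sum.swap)
       (auto simp: arc_gain_def sum_distrib_left sum_distrib_right mult_ac intro!: sum.cong)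
  have idling: "(\<Sum>w\<in>W. (prio w - lam w) *
        (\<Sum>i\<in>inner_waypoints n. point_coeff \<rho> (pos i) (tgt w) \<eta> * y i)) =
      (\<Sum>i\<in>inner_waypoints n. idle_gain pos W tgt prio \<rho> \<eta> lam i * y i)"
    unfolding sum_distrib_left
    by (subst sum.swap)
       (auto simp: idle_gain_def sum_distrib_left sum_distrib_right mult_ac intro!: sum.cong)
  show ?thesis
    unfolding objective_def distrib_left sum.distrib arcs idling by simp
qed

section \<open>Existence of an optimal solution\<close>

lemma compact_function_box:
  fixes K :: "'a \<Rightarrow> 'b::topological_space set"
  assumes "\<And>x. compact (K x)"
  shows "compact {f. \<forall>x. f x \<in> K x}"
proof -
  have "compactin (product_topology (\<lambda>_. euclidean) UNIV) (PiE UNIV K)"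
    using assms by (simp add: compactin_PiE)
  moreover have "PiE UNIV K = {f. \<forall>x. f x \<in> K x}"
    by auto
  ultimately show ?thesis
    by (simp add: euclidean_product_topology)
qed

text \<open>A feasible solution may take arbitrary values at the arcs outside \<open>P\<close> and at the labels
  beyond \<open>n + 1\<close>, so the feasible set itself is unbounded. Setting these values to \<open>0\<close> changes
  neither feasibility nor the objective, and leaves a compact set of solutions.\<close>

lemma optimal_on_path:
  assumes \<tau>: "0 < \<tau>min" "\<tau>min \<le> \<tau>max"
    and ex: "feasible n pos \<tau>min \<tau>max T P t\<^sub>0 y\<^sub>0"
  shows "\<exists>t y. feasible n pos \<tau>min \<tau>max T P t y \<and>
    (\<forall>t' y'. feasible n pos \<tau>min \<tau>max T P t' y' \<longrightarrow>
       objective n pos W tgt prio req \<rho> \<eta> lam P t' y'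
         \<le> objective n pos W tgt prio req \<rho> \<eta> lam P t y)"
proof -
  let ?feas = "feasible n pos \<tau>min \<tau>max T P"
  let ?obj = "objective n pos W tgt prio req \<rho> \<eta> lam P"
  let ?d = "\<lambda>e. dist (pos (fst e)) (pos (snd e))"
  let ?I = "inner_waypoints n"
  have P: "P \<in> paths n"
    using ex by (simp add: feasible_def)
  define K where "K e = (if e \<in> P then {?d e / \<tau>max .. ?d e / \<tau>min} else {0})" for e
  define L where "L i = (if i \<in> ?I \<inter> Field P then {0 .. T} else {0})" for i
  define S where "S = {(t, y). sum t P + sum y ?I \<le> T}"
  define C where "C = ({t. \<forall>e. t e \<in> K e} \<times> {y. \<forall>i. y i \<in> L i}) \<inter> S"
  have arc_times: "continuous_on UNIV (\<lambda>x :: (nat \<times> nat \<Rightarrow> real) \<times> (nat \<Rightarrow> real). fst x e)" for e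
    by (rule continuous_on_product_then_coordinatewise[OF continuous_on_fst[OF continuous_on_id]])
  have idle_times: "continuous_on UNIV (\<lambda>x :: (nat \<times> nat \<Rightarrow> real) \<times> (nat \<Rightarrow> real). snd x i)" for i
    by (rule continuous_on_product_then_coordinatewise[OF continuous_on_snd[OF continuous_on_id]])
  have "compact ({t. \<forall>e. t e \<in> K e} \<times> {y. \<forall>i. y i \<in> L i})"
    by (intro compact_Times compact_function_box) (auto simp: K_def L_def)
  moreover have "closed S"
    unfolding S_def case_prod_beta
    by (intro closed_Collect_le continuous_on_add continuous_on_sum continuous_on_const
        arc_times idle_times)
  ultimately have "compact C"
    unfolding C_def by (rule compact_Int_closed)
  have C_feasible: "?feas t y" if "(t, y) \<in> C" for t y
  proof -
    have t: "t e \<in> K e" and y: "y i \<in> L i" and le: "sum t P + sum y ?I \<le> T" for e i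
      using that by (auto simp: C_def S_def simp del: split_paired_All)
    have "?d e / \<tau>max \<le> t e \<and> t e \<le> ?d e / \<tau>min" if "e \<in> P" for e
      using t[of e] that by (simp add: K_def)
    moreover have "y i = 0" if "i \<notin> ?I \<inter> Field P" for i
      using y[of i] that by (simp add: L_def split: if_splits)
    moreover have "0 \<le> y i" for i
      using y[of i] by (auto simp: L_def split: if_splits)
    moreover have "{0, n + 1} \<inter> ?I = {}"
      by (auto simp: inner_waypoints_def)
    ultimately show ?thesis
      using P le unfolding feasible_def by (simp add: case_prod_beta disjoint_iff)
  qed
  define norm_t where "norm_t t = (\<lambda>e. if e \<in> P then t e else 0)" for t :: "nat \<times> nat \<Rightarrow> real"
  define norm_y where "norm_y y = (\<lambda>i. if i \<in> ?I then y i else 0)" for y :: "nat \<Rightarrow> real"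
  have normal_obj: "?obj (norm_t t) (norm_y y) = ?obj t y" for t y
    by (simp add: objective_affine norm_t_def norm_y_def)
  have normal_C: "(norm_t t, norm_y y) \<in> C" if f: "?feas t y" for t y
  proof -
    have t: "?d e / \<tau>max \<le> t e" "t e \<le> ?d e / \<tau>min" if "e \<in> P" for e
      using f that by (auto simp: feasible_def)
    have y: "0 \<le> y i" "i \<notin> Field P \<Longrightarrow> y i = 0" if "i \<in> ?I" for i
      using f that by (auto simp: feasible_def)
    have le: "sum t P + sum y ?I \<le> T"
      using f by (simp add: feasible_def)
    have "0 \<le> t e" if "e \<in> P" for e
      using \<tau> by (intro order_trans[OF _ t(1)[OF that]]) simp
    then have "sum y ?I \<le> T"
      using le sum_nonneg[of P t] by simp
    then have "y i \<le> T" if "i \<in> ?I" for i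
      using member_le_sum[OF that, of y] y(1) finite_inner_waypoints by fastforce
    then show ?thesis
      using t y le by (auto simp: C_def S_def K_def L_def norm_t_def norm_y_def simp del: split_paired_All)
  qed
  have "C \<noteq> {}"
    using normal_C[OF ex] by blast
  have "continuous_on UNIV (\<lambda>x. ?obj (fst x) (snd x))"
    unfolding objective_affine
    by (intro continuous_on_add continuous_on_sum continuous_on_mult continuous_on_const
        arc_times idle_times)
  then have "continuous_on C (\<lambda>x. ?obj (fst x) (snd x))"
    by (rule continuous_on_subset) simp
  with \<open>compact C\<close> \<open>C \<noteq> {}\<close> obtain t y where ty: "(t, y) \<in> C"
    and max: "\<forall>x\<in>C. ?obj (fst x) (snd x) \<le> ?obj t y"
    using continuous_attains_sup[of C "\<lambda>x. ?obj (fst x) (snd x)"] by auto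
  have "?obj t' y' \<le> ?obj t y" if "?feas t' y'" for t' y'
    using max normal_C[OF that] normal_obj[of t' y'] by fastforce
  with C_feasible[OF ty] show ?thesis by blast
qed

lemma optimal_exists:
  assumes \<tau>: "0 < \<tau>min" "\<tau>min \<le> \<tau>max"
    and ex: "\<exists>P t y. feasible n pos \<tau>min \<tau>max T P t y"
  shows "\<exists>P t y. optimal n pos W tgt prio req \<tau>min \<tau>max T \<rho> \<eta> lam P t y"
proof -
  let ?feas = "feasible n pos \<tau>min \<tau>max T"
  let ?obj = "objective n pos W tgt prio req \<rho> \<eta> lam"
  define Q where "Q = {P. \<exists>t y. ?feas P t y}"
  have "Q \<subseteq> paths n"
    by (auto simp: Q_def feasible_def)
  then have "finite Q"
    using finite_paths finite_subset by blast
  have "\<forall>P\<in>Q. \<exists>t y. ?feas P t y \<and> (\<forall>t' y'. ?feas P t' y' \<longrightarrow> ?obj P t' y' \<le> ?obj P t y)"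
    using optimal_on_path[OF \<tau>] unfolding Q_def by blast
  then obtain t y where ty: "\<And>P. P \<in> Q \<Longrightarrow> ?feas P (t P) (y P)"
    and max: "\<And>P t' y'. P \<in> Q \<Longrightarrow> ?feas P t' y' \<Longrightarrow> ?obj P t' y' \<le> ?obj P (t P) (y P)"
    by metis
  have "Q \<noteq> {}"
    using ex by (auto simp: Q_def)
  with \<open>finite Q\<close> obtain P where P: "P \<in> Q"
    and best: "\<And>P'. P' \<in> Q \<Longrightarrow> ?obj P' (t P') (y P') \<le> ?obj P (t P) (y P)"
    using ex_is_arg_min_if_finite[of Q "\<lambda>P. - ?obj P (t P) (y P)"] by (force simp: is_arg_min_linorder)
  have "?obj P' t' y' \<le> ?obj P (t P) (y P)" if "?feas P' t' y'" for P' t' y'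
  proof -
    have "P' \<in> Q"
      using that by (auto simp: Q_def)
    then show ?thesis
      using max[OF _ that] best order_trans by blast
  qed
  with ty[OF P] show ?thesis
    unfolding optimal_def by blast
qed

section \<open>Concentrating the idling time\<close>

text \<open>Every unit of idling time earns at most as much as it would at a visited inner waypoint of
  largest gain. If the path visits no inner waypoint, the given solution does not idle at all.\<close>

lemma concentrate_idling:
  assumes f: "feasible n pos \<tau>min \<tau>max T P t y"
  shows "\<exists>y'. feasible n pos \<tau>min \<tau>max T P t y' \<and>
    objective n pos W tgt prio req \<rho> \<eta> lam P t y
      \<le> objective n pos W tgt prio req \<rho> \<eta> lam P t y' \<and>
    (\<exists>\<^sub>\<le>\<^sub>1v. v \<in> inner_waypoints n \<and> y' v > 0)"
proof -
  let ?I = "inner_waypoints n"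
  let ?B = "idle_gain pos W tgt prio \<rho> \<eta> lam"
  have y_nonneg: "0 \<le> y i" and y_zero: "i \<notin> Field P \<Longrightarrow> y i = 0" if "i \<in> ?I" for i
    using f that by (auto simp: feasible_def)
  show ?thesis
  proof (cases "?I \<inter> Field P = {}")
    case True
    then have "y v = 0" if "v \<in> ?I" for v
      using y_zero that by blast
    then have "\<exists>\<^sub>\<le>\<^sub>1v. v \<in> ?I \<and> y v > 0"
      by (auto simp: Uniq_def)
    with f show ?thesis by blast
  next
    case False
    then obtain v where v: "v \<in> ?I" "v \<in> Field P"
      and best: "\<And>i. i \<in> ?I \<inter> Field P \<Longrightarrow> ?B i \<le> ?B v"
      using ex_is_arg_min_if_finite[of "?I \<inter> Field P" "\<lambda>i. - ?B i"] finite_inner_waypoints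
      by (force simp: is_arg_min_linorder)
    define y' where "y' i = (if i = v then sum y ?I else 0)" for i
    have sum_y': "sum y' ?I = sum y ?I"
      using v finite_inner_waypoints by (simp add: y'_def)
    have "0 \<le> sum y ?I"
      using y_nonneg by (rule sum_nonneg)
    moreover have "v \<notin> {0, n + 1}"
      using v(1) by (simp add: inner_waypoints_def)
    ultimately have feas: "feasible n pos \<tau>min \<tau>max T P t y'"
      using f v sum_y' unfolding feasible_def by (auto simp: y'_def)
    have "(\<Sum>i\<in>?I. ?B i * y i) \<le> (\<Sum>i\<in>?I. ?B v * y i)"
    proof (rule sum_mono)
      fix i assume i: "i \<in> ?I"
      show "?B i * y i \<le> ?B v * y i"
      proof (cases "i \<in> Field P")
        case True
        then show ?thesis
          using best i y_nonneg by (simp add: mult_right_mono)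
      next
        case False
        then show ?thesis
          using y_zero i by simp
      qed
    qed
    also have "\<dots> = (\<Sum>i\<in>?I. ?B i * y' i)"
      using v(1) finite_inner_waypoints by (simp add: y'_def sum_distrib_left if_distrib cong: if_cong)
    finally have "objective n pos W tgt prio req \<rho> \<eta> lam P t y
        \<le> objective n pos W tgt prio req \<rho> \<eta> lam P t y'"
      by (simp add: objective_affine)
    moreover have "\<exists>\<^sub>\<le>\<^sub>1v. v \<in> ?I \<and> y' v > 0"
      by (auto simp: Uniq_def y'_def split: if_splits)
    ultimately show ?thesis
      using feas by blast
  qed
qed

theorem proposition3p1:
  fixes n :: nat
    and pos :: "nat \<Rightarrow> real^2"
    and W :: "'w set"
    and tgt :: "'w \<Rightarrow> real^2"
    and prio req lam :: "'w \<Rightarrow> real"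
    and \<tau>min \<tau>max T \<rho> \<eta> :: real
  assumes "finite W"
    and "\<And>i j. (i, j) \<in> arcs n \<Longrightarrow> dist (pos i) (pos j) > 0"
    and "0 < \<tau>min" and "\<tau>min \<le> \<tau>max"
    and "\<And>i j w. (i, j) \<in> arcs n \<Longrightarrow> w \<in> W \<Longrightarrow>
           arc_coeff_well_defined (pos i) (pos j) (tgt w) \<eta>"
    and "\<And>i w. i \<in> inner_waypoints n \<Longrightarrow> w \<in> W \<Longrightarrow>
           point_coeff_well_defined (pos i) (tgt w) \<eta>"
    and "\<exists>P t y. feasible n pos \<tau>min \<tau>max T P t y"
  shows "\<exists>P t y. optimal n pos W tgt prio req \<tau>min \<tau>max T \<rho> \<eta> lam P t y \<and>
           (\<exists>\<^sub>\<le>\<^sub>1v. v \<in> inner_waypoints n \<and> y v > 0)"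
proof -
  obtain P t y where opt: "optimal n pos W tgt prio req \<tau>min \<tau>max T \<rho> \<eta> lam P t y"
    using optimal_exists[OF assms(3,4,7)] by blast
  then have feas: "feasible n pos \<tau>min \<tau>max T P t y"
    by (simp add: optimal_def)
  obtain y' where "feasible n pos \<tau>min \<tau>max T P t y'"
    and "objective n pos W tgt prio req \<rho> \<eta> lam P t y
      \<le> objective n pos W tgt prio req \<rho> \<eta> lam P t y'"
    and one: "\<exists>\<^sub>\<le>\<^sub>1v. v \<in> inner_waypoints n \<and> y' v > 0"
    using concentrate_idling[OF feas] by blast
  with opt have "optimal n pos W tgt prio req \<tau>min \<tau>max T \<rho> \<eta> lam P t y'"
    unfolding optimal_def using order_trans by blast
  with one show ?thesis by blast
qed

end
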